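(* There exist absolute constants $c,C>0$ such that the following holds. Let $n\ge 6$, $d\ge1$, $\sigma>0$, consider the homoscedastic model $\sigma_1=\dots=\sigma_n=\sigma$, and let $$\kappa=2^{-5/2}\sigma\max\big\{(\log n)^{1/2},(c\,d\log n)^{1/4}\big\},\qquad \Theta_\kappa=\{\boldsymbol\theta\in(\mathbb R^d)^n:\ \kappa(\boldsymbol\theta)\ge\kappa\}.$$ Then $$\inf_{\hat\pi}\ \max_{\pi^*\in\mathfrak S_n}\ \sup_{\boldsymbol\theta\in\Theta_\kappa}\mathbf P_{\boldsymbol\theta,\boldsymbol\sigma,\pi^*}(\hat\pi\ne\pi^* )>C,$$ where the infimum is over all estimators $\hat\pi$ (measurable functions of the data with values in $\mathfrak S_n$).
   Context: Model: integers $n\ge2$, $d\ge1$. Unknown parameters: $\boldsymbol\theta=(\theta_1,\dots,\theta_n)$ with $\theta_i\in\mathbb R^d$, noise levels $\boldsymbol\sigma=(\sigma_1,\dots,\sigma_n)$ with $\sigma_i>0$, and a permutation $\pi^*\in\mathfrak S_n$ (the symmetric group on $\{1,\dots,n\}$). One observes $X_i=\theta_i+\sigma_i\xi_i$, $X_i^\#=\theta_{\pi^*(i)}+\sigma_i^\#\xi_i^\#$, $i=1,\dots,n$, where $\sigma_i^\#=\sigma_{\pi^*(i)}$ and $\xi_1,\dots,\xi_n,\xi_1^\#,\dots,\xi_n^\#$ are i.i.d. $\mathcal N(0,I_d)$. The law of the data is $\mathbf P_{\boldsymbol\theta,\boldsymbol\sigma,\pi^*}$. Separation distance: $\kappa(\boldsymbol\theta)=\min_{i\ne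 j}\|\theta_i-\theta_j\|$. *)

theory Defs
  imports "HOL-Probability.Probability" "HOL-Combinatorics.Permutations"
begin

text \<open>Vectors theta_i in R^d are encoded as theta i :: nat => real, coordinates k < d.
  A parameter is theta :: nat => nat => real (only i < n, k < d matter).
  Data (X, X#) is encoded as a pair of functions on the index set {..<n} x {..<d}.\<close>

definition idx :: "nat \<Rightarrow> nat \<Rightarrow> (nat \<times> nat) set" where
  "idx n d = {..<n} \<times> {..<d}"

definition vdist :: "nat \<Rightarrow> (nat \<Rightarrow> nat \<Rightarrow> real) \<Rightarrow> nat \<Rightarrow> nat \<Rightarrow> real" where
  "vdist d \<theta> i j = sqrt (\<Sum>k<d. (\<theta> i k - \<theta> j k)^2)"

definition sep :: "nat \<Rightarrow> nat \<Rightarrow> (nat \<Rightarrow> nat \<Rightarrow> real) \<Rightarrow> real" where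
  "sep n d \<theta> = Min {vdist d \<theta> i j | i j. i < n \<and> j < n \<and> i \<noteq> j}"

text \<open>Law P_{theta,sigma,pi}: X_i = theta_i + sigma_i xi_i,
  X#_i = theta_{pi i} + sigma_{pi i} xi#_i, all coordinates independent Gaussians.\<close>
definition law :: "nat \<Rightarrow> nat \<Rightarrow> (nat \<Rightarrow> nat \<Rightarrow> real) \<Rightarrow> (nat \<Rightarrow> real) \<Rightarrow> (nat \<Rightarrow> nat)
    \<Rightarrow> ((nat \<times> nat \<Rightarrow> real) \<times> (nat \<times> nat \<Rightarrow> real)) measure" where
  "law n d \<theta> \<sigma> \<pi> =
     (PiM (idx n d) (\<lambda>(i,k). density lborel (normal_density (\<theta> i k) (\<sigma> i))))
     \<Otimes>\<^sub>M
     (PiM (idx n d) (\<lambda>(i,k). density lborel (normal_density (\<theta> (\<pi> i) k) (\<sigma> (\<pi> i)))))"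

definition data_space :: "nat \<Rightarrow> nat \<Rightarrow> ((nat \<times> nat \<Rightarrow> real) \<times> (nat \<times> nat \<Rightarrow> real)) measure" where
  "data_space n d = (PiM (idx n d) (\<lambda>_. borel)) \<Otimes>\<^sub>M (PiM (idx n d) (\<lambda>_. borel))"

definition estimators :: "nat \<Rightarrow> nat \<Rightarrow> (((nat \<times> nat \<Rightarrow> real) \<times> (nat \<times> nat \<Rightarrow> real)) \<Rightarrow> (nat \<Rightarrow> nat)) set" where
  "estimators n d = measurable (data_space n d) (count_space {p. p permutes {..<n}})"

definition err_prob where
  "err_prob n d \<theta> \<sigma> \<pi> \<pi>h =
     measure (law n d \<theta> \<sigma> \<pi>) {\<omega> \<in> space (law n d \<theta> \<sigma> \<pi>). \<pi>h \<omega> \<noteq> \<pi>}"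

end

theory Submission
  imports Defs
begin

text \<open>Group the points into \<open>M = n div 2\<close> pairs with known, widely separated centres, and displace
  the two points of a pair by \<open>\<plusminus>h/2\<close> in every coordinate, where \<open>d h\<^sup>2 = \<kappa>\<^sup>2\<close> and the signs are
  independent and uniform. The hypotheses are the \<open>M\<close> transpositions of a pair. Relative to the law
  with all points at their centres, the likelihood of such a sign mixture is a product over pairs
  and coordinates of factors \<open>exp (-\<tau>) cosh (u (p \<plusminus> q))\<close>. By Cauchy-Schwarz against the mixture
  without a swap it suffices that the chi-square divergence from it is small compared to \<open>M\<close>. In one
  coordinate that divergence is bounded both by \<open>exp (4 \<tau>)\<close> (convexity) and by \<open>exp (240 \<tau>\<^sup>2)\<close> (the
  first order terms cancel); these give the two regimes in the definition of \<open>\<kappa>\<close>.\<close>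

section \<open>Shifts of Gaussian product measures\<close>

definition gauss :: "'i set \<Rightarrow> ('i \<Rightarrow> real) \<Rightarrow> real \<Rightarrow> ('i \<Rightarrow> real) measure" where
  "gauss I \<mu> \<sigma> = PiM I (\<lambda>i. density lborel (normal_density (\<mu> i) \<sigma>))"

lemma prob_space_gauss: "\<sigma> > 0 \<Longrightarrow> prob_space (gauss I \<mu> \<sigma>)"
  unfolding gauss_def by (intro prob_space_PiM prob_space_normal_density)

lemma sets_gauss [measurable_cong]: "sets (gauss I \<mu> \<sigma>) = sets (PiM I (\<lambda>_. borel))"
  unfolding gauss_def by (intro sets_PiM_cong) auto

lemma normal_density_shift:
  assumes "\<sigma> > 0"
  shows "normal_density \<mu> \<sigma> x * exp (a * (x - \<mu>) - \<sigma>\<^sup>2 * a\<^sup>2 / 2) = normal_density (\<mu> + \<sigma>\<^sup>2 * a) \<sigma> x"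
proof -
  have "- (x - \<mu>)\<^sup>2 / (2 * \<sigma>\<^sup>2) + (a * (x - \<mu>) - \<sigma>\<^sup>2 * a\<^sup>2 / 2) = - (x - (\<mu> + \<sigma>\<^sup>2 * a))\<^sup>2 / (2 * \<sigma>\<^sup>2)"
    using assms by (simp add: field_simps power2_eq_square)
  then show ?thesis
    unfolding normal_density_def by (metis exp_add mult.assoc)
qed

text \<open>Finite-dimensional Cameron-Martin formula. Writing the shift as
  \<open>\<sigma>\<^sup>2 * a\<close> makes \<open>a\<close> the slope of the log-likelihood. The
  two measures are compared on boxes, where both sides factorise over the coordinates.\<close>

lemma gauss_shift:
  assumes I: "finite I" and \<sigma>: "\<sigma> > 0"
  shows "gauss I (\<lambda>i. \<mu> i + \<sigma>\<^sup>2 * a i) \<sigma> =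
    density (gauss I \<mu> \<sigma>) (\<lambda>x. ennreal (exp (\<Sum>i\<in>I. a i * (x i - \<mu> i) - \<sigma>\<^sup>2 * (a i)\<^sup>2 / 2)))"
    (is "_ = density _ ?L")
proof -
  let ?N = "\<lambda>\<nu>. density lborel (\<lambda>x. ennreal (normal_density \<nu> \<sigma> x))"
  interpret N': product_sigma_finite "\<lambda>i. ?N (\<mu> i + \<sigma>\<^sup>2 * a i)"
    unfolding product_sigma_finite_def
    by (intro allI prob_space_imp_sigma_finite prob_space_normal_density \<sigma>)
  interpret N: product_sigma_finite "\<lambda>i. ?N (\<mu> i)"
    unfolding product_sigma_finite_def
    by (intro allI prob_space_imp_sigma_finite prob_space_normal_density \<sigma>)
  show ?thesis
    unfolding gauss_def[of _ "\<lambda>i. \<mu> i + \<sigma>\<^sup>2 * a i"]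
  proof (rule sym, rule N'.PiM_eqI[OF I])
    show "sets (density (gauss I \<mu> \<sigma>) ?L) = sets (PiM I (\<lambda>i. ?N (\<mu> i + \<sigma>\<^sup>2 * a i)))"
      unfolding sets_density sets_gauss by (intro sets_PiM_cong) auto
  next
    fix A assume A: "\<And>i. i \<in> I \<Longrightarrow> A i \<in> sets (?N (\<mu> i + \<sigma>\<^sup>2 * a i))"
    let ?l = "\<lambda>i x. ennreal (exp (a i * (x - \<mu> i) - \<sigma>\<^sup>2 * (a i)\<^sup>2 / 2))"
    have A': "A i \<in> sets borel" if "i \<in> I" for i using A[OF that] by simp
    have "Pi\<^sub>E I A \<in> sets (gauss I \<mu> \<sigma>)"
      unfolding sets_gauss using I A' by (intro sets_PiM_I_finite) auto
    moreover have "?L \<in> borel_measurable (gauss I \<mu> \<sigma>)"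
      by measurable
    ultimately have "emeasure (density (gauss I \<mu> \<sigma>) ?L) (Pi\<^sub>E I A)
        = (\<integral>\<^sup>+x. ?L x * indicator (Pi\<^sub>E I A) x \<partial>gauss I \<mu> \<sigma>)"
      by (intro emeasure_density)
    also have "\<dots> = (\<integral>\<^sup>+x. (\<Prod>i\<in>I. ?l i (x i) * indicator (A i) (x i)) \<partial>gauss I \<mu> \<sigma>)"
    proof (rule nn_integral_cong)
      fix x assume x: "x \<in> space (gauss I \<mu> \<sigma>)"
      then have "indicator (Pi\<^sub>E I A) x = (\<Prod>i\<in>I. indicator (A i) (x i) :: ennreal)"
        using I by (auto simp: indicator_def space_PiM gauss_def PiE_iff intro: prod_zero)
      moreover have "?L x = (\<Prod>i\<in>I. ?l i (x i))"
        using I by (simp add: exp_sum prod_ennreal)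
      ultimately show "?L x * indicator (Pi\<^sub>E I A) x = (\<Prod>i\<in>I. ?l i (x i) * indicator (A i) (x i))"
        by (simp add: prod.distrib)
    qed
    also have "\<dots> = (\<Prod>i\<in>I. \<integral>\<^sup>+x. ?l i x * indicator (A i) x \<partial>?N (\<mu> i))"
      unfolding gauss_def using I A' by (intro N.product_nn_integral_prod) auto
    also have "\<dots> = (\<Prod>i\<in>I. emeasure (?N (\<mu> i + \<sigma>\<^sup>2 * a i)) (A i))"
    proof (rule prod.cong[OF refl])
      fix i assume i: "i \<in> I"
      note [measurable] = A'[OF i]
      show "(\<integral>\<^sup>+x. ?l i x * indicator (A i) x \<partial>?N (\<mu> i)) = emeasure (?N (\<mu> i + \<sigma>\<^sup>2 * a i)) (A i)"
        by (subst nn_integral_density)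
          (auto simp: emeasure_density normal_density_shift[OF \<sigma>, symmetric] ennreal_mult
            mult.assoc intro!: nn_integral_cong)
    qed
    finally show "emeasure (density (gauss I \<mu> \<sigma>) ?L) (Pi\<^sub>E I A)
        = (\<Prod>i\<in>I. emeasure (?N (\<mu> i + \<sigma>\<^sup>2 * a i)) (A i))" .
  qed
qed

lemma gauss_pair_shift:
  assumes I: "finite I" and J: "finite J" and \<sigma>: "\<sigma> > 0"
  shows "gauss I (\<lambda>i. \<mu> i + \<sigma>\<^sup>2 * a i) \<sigma> \<Otimes>\<^sub>M gauss J (\<lambda>i. \<nu> i + \<sigma>\<^sup>2 * b i) \<sigma> =
    density (gauss I \<mu> \<sigma> \<Otimes>\<^sub>M gauss J \<nu> \<sigma>)
      (\<lambda>w. ennreal (exp ((\<Sum>i\<in>I. a i * (fst w i - \<mu> i) - \<sigma>\<^sup>2 * (a i)\<^sup>2 / 2) +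
                      (\<Sum>i\<in>J. b i * (snd w i - \<nu> i) - \<sigma>\<^sup>2 * (b i)\<^sup>2 / 2))))"
proof -
  have [measurable]: "(\<lambda>x. ennreal (exp (\<Sum>i\<in>J. b i * (x i - \<nu> i) - \<sigma>\<^sup>2 * (b i)\<^sup>2 / 2))) \<in> borel_measurable (gauss J \<nu> \<sigma>)"
    "(\<lambda>x. ennreal (exp (\<Sum>i\<in>I. a i * (x i - \<mu> i) - \<sigma>\<^sup>2 * (a i)\<^sup>2 / 2))) \<in> borel_measurable (gauss I \<mu> \<sigma>)"
    by measurable
  \<comment> \<open>The product of densities needs the second factor to be sigma-finite; folding it
    back into a shifted Gaussian shows that it is a probability measure.\<close>
  show ?thesis
    unfolding gauss_shift[OF I \<sigma>] gauss_shift[OF J \<sigma>]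
    by (subst pair_measure_density)
      (auto simp: gauss_shift[OF J \<sigma>, symmetric] split_beta ennreal_mult exp_add
        intro!: prob_space_imp_sigma_finite prob_space_gauss \<sigma> density_cong)
qed

section \<open>The likelihood ratio in one coordinate of a pair\<close>

text \<open>The finite linear combinations of the exponentials \<open>(p, q) \<mapsto> exp (\<alpha> p + \<beta> q)\<close>, together
  with their mean when \<open>p\<close> and \<open>q\<close> are independent centred Gaussians of variance \<open>2 \<sigma>\<^sup>2\<close>.\<close>

inductive exp_comb :: "real \<Rightarrow> (real \<Rightarrow> real \<Rightarrow> real) \<Rightarrow> real \<Rightarrow> bool" for \<sigma> where
  exp_comb_exp: "exp_comb \<sigma> (\<lambda>p q. exp (\<alpha> * p + \<beta> * q)) (exp (\<sigma>\<^sup>2 * (\<alpha>\<^sup>2 + \<beta>\<^sup>2)))"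
| exp_comb_add: "exp_comb \<sigma> f m \<Longrightarrow> exp_comb \<sigma> g l \<Longrightarrow> exp_comb \<sigma> (\<lambda>p q. f p q + g p q) (m + l)"
| exp_comb_cmult: "exp_comb \<sigma> f m \<Longrightarrow> exp_comb \<sigma> (\<lambda>p q. c * f p q) (c * m)"

lemma exp_comb_cosh:
  "exp_comb \<sigma> (\<lambda>p q. c * cosh (\<alpha> * p + \<beta> * q)) (c * exp (\<sigma>\<^sup>2 * (\<alpha>\<^sup>2 + \<beta>\<^sup>2)))"
proof -
  have "exp_comb \<sigma> (\<lambda>p q. c * (1/2 * (exp (\<alpha> * p + \<beta> * q) + exp ((-\<alpha>) * p + (-\<beta>) * q))))
    (c * (1/2 * (exp (\<sigma>\<^sup>2 * (\<alpha>\<^sup>2 + \<beta>\<^sup>2)) + exp (\<sigma>\<^sup>2 * ((-\<alpha>)\<^sup>2 + (-\<beta>)\<^sup>2)))))"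
    by (intro exp_comb_cmult exp_comb_add exp_comb_exp)
  then show ?thesis
    by (simp add: cosh_def field_simps)
qed

text \<open>The factor of one pair and one coordinate, averaged over the sign; \<open>p\<close> and \<open>q\<close> are the differences
  of the two observations in each sample, and \<open>z = -1\<close> when the pair is swapped.\<close>
definition lr :: "real \<Rightarrow> real \<Rightarrow> real \<Rightarrow> real \<Rightarrow> real \<Rightarrow> real" where
  "lr \<sigma> u z p q = exp (- 2 * \<sigma>\<^sup>2 * u\<^sup>2) * cosh (u * (p + z * q))"

lemma lr_pos: "lr \<sigma> u z p q > 0"
  unfolding lr_def by (simp add: cosh_real_pos)

text \<open>The prefactor of \<open>lr\<close> is exactly the inverse of the Gaussian mean of the
  cosh, for either orientation of the pair.\<close>

lemma exp_comb_lr: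
  assumes "z\<^sup>2 = 1"
  shows "exp_comb \<sigma> (lr \<sigma> u z) 1"
proof -
  have "exp_comb \<sigma> (\<lambda>p q. exp (- 2 * \<sigma>\<^sup>2 * u\<^sup>2) * cosh (u * p + (u * z) * q))
      (exp (- 2 * \<sigma>\<^sup>2 * u\<^sup>2) * exp (\<sigma>\<^sup>2 * (u\<^sup>2 + (u * z)\<^sup>2)))"
    by (rule exp_comb_cosh)
  also have "exp (- 2 * \<sigma>\<^sup>2 * u\<^sup>2) * exp (\<sigma>\<^sup>2 * (u\<^sup>2 + (u * z)\<^sup>2)) = 1"
    using assms by (simp add: exp_add[symmetric] power_mult_distrib algebra_simps)
  finally show ?thesis
    by (simp add: lr_def[abs_def] algebra_simps)
qed

text \<open>Joint convexity of \<open>(a, b) \<mapsto> a\<^sup>2 / b\<close>.\<close>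
lemma lr_ratio_convex:
  "\<exists>U. exp_comb \<sigma> U (exp (8 * \<sigma>\<^sup>2 * u\<^sup>2)) \<and> (\<forall>p q. (lr \<sigma> u (-1) p q)\<^sup>2 \<le> U p q * lr \<sigma> u 1 p q)"
proof (intro exI conjI allI)
  \<comment> \<open>With A = u(p - q) and B = u(p + q), averaging (exp A)^2 / exp B over the common
    sign gives cosh (2A - B), and 2A - B = u(p - 3q).\<close>
  let ?U = "\<lambda>p q. exp (- 2 * \<sigma>\<^sup>2 * u\<^sup>2) * cosh (u * p + (- 3 * u) * q)"
  have "exp_comb \<sigma> ?U (exp (- 2 * \<sigma>\<^sup>2 * u\<^sup>2) * exp (\<sigma>\<^sup>2 * (u\<^sup>2 + (- 3 * u)\<^sup>2)))"
    by (rule exp_comb_cosh)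
  also have "exp (- 2 * \<sigma>\<^sup>2 * u\<^sup>2) * exp (\<sigma>\<^sup>2 * (u\<^sup>2 + (- 3 * u)\<^sup>2)) = exp (8 * \<sigma>\<^sup>2 * u\<^sup>2)"
    by (simp add: exp_add[symmetric] power_mult_distrib algebra_simps)
  finally show "exp_comb \<sigma> ?U (exp (8 * \<sigma>\<^sup>2 * u\<^sup>2))" .
next
  fix p q
  have ineq: "(cosh A)\<^sup>2 \<le> cosh (2 * A - B) * cosh B" for A B :: real
  proof -
    have "cosh (2 * A - B) * cosh B = (cosh (2 * A) + cosh (2 * (A - B))) / 2"
      using cosh_add[of "2 * A - B" B] cosh_diff[of "2 * A - B" B] by (simp add: algebra_simps)
    moreover have "cosh (2 * A) = 2 * (cosh A)\<^sup>2 - 1"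
      by (rule cosh_double_cosh)
    moreover have "cosh (2 * (A - B)) \<ge> 1"
      by (rule cosh_real_ge_1)
    ultimately show ?thesis by simp
  qed
  have "(cosh (u * (p - q)))\<^sup>2 \<le> cosh (u * p + (- 3 * u) * q) * cosh (u * (p + q))"
    using ineq[of "u * (p - q)" "u * (p + q)"] by (simp add: algebra_simps)
  from mult_left_mono[OF this, of "(exp (- 2 * \<sigma>\<^sup>2 * u\<^sup>2))\<^sup>2"]
  show "(lr \<sigma> u (-1) p q)\<^sup>2 \<le> exp (- 2 * \<sigma>\<^sup>2 * u\<^sup>2) * cosh (u * p + (- 3 * u) * q) * lr \<sigma> u 1 p q"
    by (simp add: lr_def power_mult_distrib power2_eq_square mult_ac)
qed

text \<open>With t = 1 + s the left side is the moment arising in the second order bound. Both sides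
  agree up to first order in s; on the left (times 4) the remaining powers are dominated by s^2,
  with coefficients summing to 179 < 4 * 60.\<close>

lemma moment_polynomial_bound:
  fixes s :: real
  assumes "0 \<le> s" "s \<le> 1"
  shows "(1 + (1 + s)^4) * (7 - 6 * (1 + s) + (1 + s)^4) / 4 \<le> (1 + s) * (1 + 60 * s\<^sup>2)"
proof -
  have p: "s ^ (k + 2) \<le> s\<^sup>2" for k
    using assms by (intro power_decreasing) auto
  have "s^3 \<le> s^2" "s^4 \<le> s^2" "s^5 \<le> s^2" "s^6 \<le> s^2" "s^7 \<le> s^2" "s^8 \<le> s^2" "0 \<le> s^3"
    using p[of 1] p[of 2] p[of 3] p[of 4] p[of 5] p[of 6] assms by (simp_all add: numeral_eq_Suc)
  moreover have "(1 + s) * (1 + 60 * s\<^sup>2) * 4 - (1 + (1 + s)^4) * (7 - 6 * (1 + s) + (1 + s)^4)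
     = 240 * s^3 + 240 * s^2 - (16 * s^2 + 28 * s^3 + 48 * s^4 + 50 * s^5 + 28 * s^6 + 8 * s^7 + s^8)"
    by algebra
  ultimately have "0 \<le> (1 + s) * (1 + 60 * s\<^sup>2) * 4 - (1 + (1 + s)^4) * (7 - 6 * (1 + s) + (1 + s)^4)"
    by linarith
  then show ?thesis by simp
qed

text \<open>With \<open>w = cosh B \<ge> 1\<close>, the bound \<open>1 / w \<le> 3 - 3 w + w\<^sup>2\<close>, i.e. \<open>(w - 1)\<^sup>3 \<ge> 0\<close>, makes the
  squared likelihood ratio a combination of exponentials, whose mean has no first order term.\<close>
lemma lr_ratio_second_order:
  assumes small: "2 * \<sigma>\<^sup>2 * u\<^sup>2 \<le> 1/2"
  shows "\<exists>U X. exp_comb \<sigma> U X \<and> 0 \<le> X \<and> X \<le> exp (240 * (2 * \<sigma>\<^sup>2 * u\<^sup>2)\<^sup>2) \<and>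
    (\<forall>p q. (lr \<sigma> u (-1) p q)\<^sup>2 \<le> U p q * lr \<sigma> u 1 p q)"
proof -
  define \<tau> where "\<tau> = 2 * \<sigma>\<^sup>2 * u\<^sup>2"
  define t where "t = exp \<tau>"
  define cs where "cs = (\<lambda>c \<alpha> \<beta> p q. c * cosh (\<alpha> * p + \<beta> * q) :: real)"
  \<comment> \<open>The expansion of (cosh A)^2 (3 - 3 cosh B + (cosh B)^2) into single cosh terms,
    with A = u(p - q) and B = u(p + q), so that its mean can be read off termwise.\<close>
  define V where "V = (\<lambda>p q. cs (7/4) 0 0 p q + cs (-3/2) u u p q + cs (1/4) (2*u) (2*u) p q
      + cs (7/4) (2*u) (-2*u) p q + cs (-3/4) (3*u) (-u) p q + cs (-3/4) u (-3*u) p q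
      + cs (1/8) (4*u) 0 p q + cs (1/8) 0 (-4*u) p q)"
  define m where "m = (\<lambda>c \<alpha> \<beta>. c * exp (\<sigma>\<^sup>2 * (\<alpha>\<^sup>2 + \<beta>\<^sup>2)))"
  have cs: "exp_comb \<sigma> (\<lambda>p q. cs c \<alpha> \<beta> p q) (m c \<alpha> \<beta>)" for c \<alpha> \<beta>
    unfolding cs_def m_def by (rule exp_comb_cosh)
  let ?m = "m (7/4) 0 0 + m (-3/2) u u + m (1/4) (2*u) (2*u) + m (7/4) (2*u) (-2*u)
      + m (-3/4) (3*u) (-u) + m (-3/4) u (-3*u) + m (1/8) (4*u) 0 + m (1/8) 0 (-4*u)"
  have "exp_comb \<sigma> V ?m"
    unfolding V_def by (intro exp_comb_add cs)
  then have U: "exp_comb \<sigma> (\<lambda>p q. exp (-\<tau>) * V p q) (exp (-\<tau>) * ?m)"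
    by (rule exp_comb_cmult)
  have tp: "exp (real k * \<tau>) = t ^ k" for k
    unfolding t_def by (simp add: exp_of_nat_mult)
  \<comment> \<open>Every exponent that occurs is an integer multiple of \<open>\<tau>\<close>, so
    the mean is a polynomial in \<open>t\<close>.\<close>
  have m: "m c \<alpha> \<beta> = c * t ^ k" if "\<alpha>\<^sup>2 + \<beta>\<^sup>2 = 2 * real k * u\<^sup>2" for c \<alpha> \<beta> k
    unfolding m_def that tp[symmetric] \<tau>_def by (simp add: algebra_simps)
  have "?m = (7/4) * t^0 + (-3/2) * t^1 + (1/4) * t^4 + (7/4) * t^4
     + (-3/4) * t^5 + (-3/4) * t^5 + (1/8) * t^8 + (1/8) * t^8"
    by (intro arg_cong2[where f="(+)"] m) (simp_all add: power_mult_distrib)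
  also have "\<dots> = (1 + t^4) * (7 - 6 * t + t^4) / 4"
    by (simp add: field_simps numeral_eq_Suc)
  finally have meq: "?m = (1 + t^4) * (7 - 6 * t + t^4) / 4" .
  have \<tau>0: "0 \<le> \<tau>" unfolding \<tau>_def by simp
  have "\<tau> \<le> 1/2"
    using small unfolding \<tau>_def .
  moreover from this have "\<tau>\<^sup>2 \<le> \<tau>"
    using \<tau>0 unfolding power2_eq_square by (intro mult_left_le) auto
  ultimately have t1: "1 \<le> t" "t - 1 \<le> 2 * \<tau>" "t - 1 \<le> 1"
    using exp_bound[of \<tau>] \<tau>0 unfolding t_def by auto
  \<comment> \<open>Bernoulli gives t^4 >= 4t - 3, so the expression is at least 4 - 2t, which is
    nonnegative as t <= 2. The sign matters later, when the bound on \<open>X\<close> is raised to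
    the power \<open>d\<close>.\<close>
  have "7 - 6 * t + t^4 \<ge> 0"
    using Bernoulli_inequality[of "t - 1" 4] t1 by simp
  then have X0: "0 \<le> exp (-\<tau>) * ?m"
    unfolding meq by simp
  have "(1 + t^4) * (7 - 6 * t + t^4) / 4 \<le> t * (1 + 60 * (t - 1)\<^sup>2)"
    using moment_polynomial_bound[of "t - 1"] t1 small unfolding \<tau>_def[symmetric] by simp
  also have "\<dots> \<le> t * (1 + 60 * (2 * \<tau>)\<^sup>2)"
    using t1 by (intro mult_left_mono add_left_mono power_mono) auto
  also have "\<dots> \<le> t * exp (240 * \<tau>\<^sup>2)"
    using t1 exp_ge_add_one_self[of "240 * \<tau>\<^sup>2"] by (intro mult_left_mono) (auto simp: power_mult_distrib)
  finally have "exp (-\<tau>) * ?m \<le> exp (-\<tau>) * (t * exp (240 * \<tau>\<^sup>2))"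
    unfolding meq by (intro mult_left_mono) auto
  then have X: "exp (-\<tau>) * ?m \<le> exp (240 * \<tau>\<^sup>2)"
    unfolding t_def by (simp add: exp_minus field_simps)
  have bound: "(lr \<sigma> u (-1) p q)\<^sup>2 \<le> (exp (-\<tau>) * V p q) * lr \<sigma> u 1 p q" for p q
  proof -
    define A where "A = u * (p - q)"
    define B where "B = u * (p + q)"
    have prod: "cosh (x + y) + cosh (x - y) = 2 * cosh x * cosh y" for x y :: real
      by (simp add: cosh_add cosh_diff)
    have arg: "u * p + u * q = B" "2 * u * p + 2 * u * q = 2 * B" "2 * u * p - 2 * u * q = 2 * A"
      "3 * u * p - u * q = 2 * A + B" "u * p - 3 * u * q = 2 * A - B"
      "4 * u * p = 2 * A + 2 * B" "- (4 * u * q) = 2 * A - 2 * B"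
      unfolding A_def B_def by (simp_all add: algebra_simps)
    have "V p q = 7/4 - 3/2 * cosh B + 1/4 * cosh (2 * B) + 7/4 * cosh (2 * A)
        - 3/4 * (cosh (2 * A + B) + cosh (2 * A - B)) + 1/8 * (cosh (2 * A + 2 * B) + cosh (2 * A - 2 * B))"
      unfolding V_def cs_def arg[symmetric] by (simp add: algebra_simps)
    also have "\<dots> = (cosh A)\<^sup>2 * (3 - 3 * cosh B + (cosh B)\<^sup>2)"
      unfolding prod cosh_double_cosh by algebra
    finally have V: "V p q = (cosh A)\<^sup>2 * (3 - 3 * cosh B + (cosh B)\<^sup>2)" .
    have "0 \<le> (cosh B - 1)^3"
      using cosh_real_ge_1[of B] by simp
    also have "(cosh B - 1)^3 = (3 - 3 * cosh B + (cosh B)\<^sup>2) * cosh B - 1"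
      by algebra
    finally have "(cosh A)\<^sup>2 * 1 \<le> (cosh A)\<^sup>2 * ((3 - 3 * cosh B + (cosh B)\<^sup>2) * cosh B)"
      by (intro mult_left_mono) auto
    then have "(cosh A)\<^sup>2 \<le> V p q * cosh B"
      unfolding V by (simp add: mult_ac)
    from mult_left_mono[OF this, of "(exp (-\<tau>))\<^sup>2"] show ?thesis
      by (simp add: lr_def A_def B_def \<tau>_def power_mult_distrib power2_eq_square mult_ac)
  qed
  show ?thesis
    using U X0 X bound unfolding \<tau>_def[symmetric] by blast
qed

section \<open>The sign mixtures\<close>

lemma sum_lessThan_double:
  fixes g :: "nat \<Rightarrow> 'a::comm_monoid_add"
  shows "(\<Sum>j<2*M. g j) = (\<Sum>a<M. g (2*a) + g (2*a+1))"
  by (induction M) (simp_all add: add.assoc)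

text \<open>Points 2a and 2a+1 form pair a. The likelihood computations only need the two centres of
  a pair to coincide; their actual positions matter for the separation alone and are fixed
  later.\<close>

locale paired_points =
  fixes n d M :: nat and c :: "nat \<times> nat \<Rightarrow> real" and \<sigma> :: real
  assumes pairs_le: "2 * M \<le> n" and \<sigma>_pos: "\<sigma> > 0"
    and centre_eq: "\<And>a k. a < M \<Longrightarrow> c (2*a+1, k) = c (2*a, k)"
begin

definition blocks :: "(nat \<times> nat) set" where
  "blocks = {..<M} \<times> {..<d}"

definition G :: "((nat \<times> nat \<Rightarrow> real) \<times> (nat \<times> nat \<Rightarrow> real)) measure" where
  "G = gauss (idx n d) c \<sigma> \<Otimes>\<^sub>M gauss (idx n d) c \<sigma>"

text \<open>Opposite tilts within a pair make the likelihood depend on the data only through the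
  differences \<open>pd\<close>. Points outside the pairs stay at their centres.\<close>

definition tilt :: "(nat \<times> nat \<Rightarrow> real) \<Rightarrow> nat \<times> nat \<Rightarrow> real" where
  "tilt \<alpha> = (\<lambda>(i, k). if i < 2 * M then (-1)^i * \<alpha> (i div 2, k) else 0)"

definition pd :: "(nat \<times> nat \<Rightarrow> real) \<Rightarrow> nat \<times> nat \<Rightarrow> real" where
  "pd x b = x (2 * fst b, snd b) - x (2 * fst b + 1, snd b)"

lemma finite_blocks [simp]: "finite blocks"
  by (simp add: blocks_def)

lemma finite_idx [simp]: "finite (idx n d)"
  by (simp add: idx_def)

lemma sets_G [measurable_cong]: "sets G = sets (data_space n d)"
  unfolding G_def data_space_def by (intro sets_pair_measure_cong sets_gauss)

lemma pd_measurable [measurable]: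
  assumes "b \<in> blocks"
  shows "(\<lambda>w. pd (fst w) b) \<in> borel_measurable G" "(\<lambda>w. pd (snd w) b) \<in> borel_measurable G"
proof -
  have [measurable]: "(2 * fst b, snd b) \<in> idx n d" "(2 * fst b + 1, snd b) \<in> idx n d"
    using assms pairs_le by (auto simp: blocks_def idx_def)
  show "(\<lambda>w. pd (fst w) b) \<in> borel_measurable G" "(\<lambda>w. pd (snd w) b) \<in> borel_measurable G"
    unfolding pd_def G_def by measurable
qed

text \<open>In each pair the common centre cancels between the opposite tilts, and the two quadratic
  halves add up.\<close>

lemma sum_idx_tilt:
  "(\<Sum>i\<in>idx n d. tilt \<alpha> i * (x i - c i) - \<sigma>\<^sup>2 * (tilt \<alpha> i)\<^sup>2 / 2)
     = (\<Sum>b\<in>blocks. \<alpha> b * pd x b - \<sigma>\<^sup>2 * (\<alpha> b)\<^sup>2)"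
proof -
  let ?f = "\<lambda>i. tilt \<alpha> i * (x i - c i) - \<sigma>\<^sup>2 * (tilt \<alpha> i)\<^sup>2 / 2"
  have "(\<Sum>i\<in>idx n d. ?f i) = (\<Sum>j<n. \<Sum>k<d. ?f (j, k))"
    unfolding idx_def by (simp add: sum.cartesian_product)
  also have "\<dots> = (\<Sum>j<2*M. \<Sum>k<d. ?f (j, k))"
    using pairs_le by (intro sum.mono_neutral_right) (auto simp: tilt_def)
  also have "\<dots> = (\<Sum>a<M. \<Sum>k<d. ?f (2*a, k) + ?f (2*a+1, k))"
    unfolding sum_lessThan_double by (simp add: sum.distrib)
  also have "\<dots> = (\<Sum>a<M. \<Sum>k<d. \<alpha> (a, k) * pd x (a, k) - \<sigma>\<^sup>2 * (\<alpha> (a, k))\<^sup>2)"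
  proof (intro sum.cong refl)
    fix a k assume "a \<in> {..<M}" "k \<in> {..<d}"
    then show "?f (2*a, k) + ?f (2*a+1, k) = \<alpha> (a, k) * pd x (a, k) - \<sigma>\<^sup>2 * (\<alpha> (a, k))\<^sup>2"
      using centre_eq[of a k] by (auto simp: tilt_def pd_def algebra_simps)
  qed
  also have "\<dots> = (\<Sum>b\<in>blocks. \<alpha> b * pd x b - \<sigma>\<^sup>2 * (\<alpha> b)\<^sup>2)"
    unfolding blocks_def by (simp add: sum.cartesian_product)
  finally show ?thesis .
qed

lemma tilted_law:
  "gauss (idx n d) (\<lambda>i. c i + \<sigma>\<^sup>2 * tilt \<alpha> i) \<sigma> \<Otimes>\<^sub>M gauss (idx n d) (\<lambda>i. c i + \<sigma>\<^sup>2 * tilt \<beta> i) \<sigma>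
    = density G (\<lambda>w. ennreal (exp (\<Sum>b\<in>blocks.
        \<alpha> b * pd (fst w) b + \<beta> b * pd (snd w) b - \<sigma>\<^sup>2 * ((\<alpha> b)\<^sup>2 + (\<beta> b)\<^sup>2))))"
  unfolding gauss_pair_shift[OF finite_idx finite_idx \<sigma>_pos] sum_idx_tilt G_def sum.distrib[symmetric]
  by (simp add: algebra_simps)

section \<open>Integrals of products over pairs and coordinates\<close>

text \<open>Up to a constant the integrand is the density of a tilted law, whose total mass is one,
  so no Gaussian integral has to be computed.\<close>

lemma integral_exp:
  "has_bochner_integral G
     (\<lambda>w. exp (\<Sum>b\<in>blocks. \<alpha> b * pd (fst w) b + \<beta> b * pd (snd w) b))
     (exp (\<Sum>b\<in>blocks. \<sigma>\<^sup>2 * ((\<alpha> b)\<^sup>2 + (\<beta> b)\<^sup>2)))"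
proof -
  define L where "L = (\<lambda>w. exp (\<Sum>b\<in>blocks.
        \<alpha> b * pd (fst w) b + \<beta> b * pd (snd w) b - \<sigma>\<^sup>2 * ((\<alpha> b)\<^sup>2 + (\<beta> b)\<^sup>2)))"
  have [measurable]: "L \<in> borel_measurable G" unfolding L_def by measurable
  have "prob_space (density G (\<lambda>w. ennreal (L w)))"
    unfolding L_def tilted_law[symmetric] by (intro prob_space_pair prob_space_gauss \<sigma>_pos)
  then have "emeasure (density G (\<lambda>w. ennreal (L w))) (space G) = 1"
    using prob_space.emeasure_space_1 by fastforce
  then have "(\<integral>\<^sup>+w. ennreal (L w) \<partial>G) = 1"
    by (simp add: emeasure_density cong: nn_integral_cong)
  then have "has_bochner_integral G L 1"
    by (intro has_bochner_integral_nn_integral) (auto simp: L_def)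
  from has_bochner_integral_mult_right[OF this, of "exp (\<Sum>b\<in>blocks. \<sigma>\<^sup>2 * ((\<alpha> b)\<^sup>2 + (\<beta> b)\<^sup>2))"]
  show ?thesis
    by (simp add: L_def sum_subtractf exp_diff)
qed

text \<open>Takes the place of an independence argument: blocks are converted one at a time from a
  pure exponential to a general combination, by linearity of the integral.\<close>

lemma integral_prod_exp:
  assumes "D \<subseteq> blocks" "\<And>b. b \<in> D \<Longrightarrow> exp_comb \<sigma> (f b) (m b)"
  shows "has_bochner_integral G
     (\<lambda>w. (\<Prod>b\<in>D. f b (pd (fst w) b) (pd (snd w) b)) *
          exp (\<Sum>b\<in>blocks - D. \<alpha> b * pd (fst w) b + \<beta> b * pd (snd w) b))
     ((\<Prod>b\<in>D. m b) * exp (\<Sum>b\<in>blocks - D. \<sigma>\<^sup>2 * ((\<alpha> b)\<^sup>2 + (\<beta> b)\<^sup>2)))"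
proof -
  have "finite D" using assms(1) finite_subset finite_blocks by blast
  then show ?thesis using assms
  proof (induction D arbitrary: \<alpha> \<beta>)
    case empty
    show ?case using integral_exp by simp
  next
    case (insert b0 D)
    define R where "R = (\<lambda>w. (\<Prod>b\<in>D. f b (pd (fst w) b) (pd (snd w) b)) *
          exp (\<Sum>b\<in>blocks - insert b0 D. \<alpha> b * pd (fst w) b + \<beta> b * pd (snd w) b))"
    define r where "r = (\<Prod>b\<in>D. m b) * exp (\<Sum>b\<in>blocks - insert b0 D. \<sigma>\<^sup>2 * ((\<alpha> b)\<^sup>2 + (\<beta> b)\<^sup>2))"
    have sum_remove: "(\<Sum>b\<in>blocks - D. F b) = F b0 + (\<Sum>b\<in>blocks - insert b0 D. F b)"
      for F :: "nat \<times> nat \<Rightarrow> real"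
      using insert.hyps insert.prems by (subst sum.remove[of _ b0]) (auto simp: Diff_insert[symmetric])
    have "has_bochner_integral G (\<lambda>w. g (pd (fst w) b0) (pd (snd w) b0) * R w) (k * r)"
      if "exp_comb \<sigma> g k" for g k
      using that
    proof induction
      \<comment> \<open>An exponential in block \<open>b0\<close> is absorbed into the exponential
        over the unconverted blocks by resetting the coefficients at \<open>b0\<close>; hence the
        induction generalises over them.\<close>
      case (exp_comb_exp a a')
      have sums: "(\<Sum>b\<in>blocks - insert b0 D. (\<alpha>(b0 := a)) b * pd (fst w) b + (\<beta>(b0 := a')) b * pd (snd w) b)
          = (\<Sum>b\<in>blocks - insert b0 D. \<alpha> b * pd (fst w) b + \<beta> b * pd (snd w) b)"
        "(\<Sum>b\<in>blocks - insert b0 D. \<sigma>\<^sup>2 * (((\<alpha>(b0 := a)) b)\<^sup>2 + ((\<beta>(b0 := a')) b)\<^sup>2))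
          = (\<Sum>b\<in>blocks - insert b0 D. \<sigma>\<^sup>2 * ((\<alpha> b)\<^sup>2 + (\<beta> b)\<^sup>2))" for w
        by (auto intro!: sum.cong)
      have "has_bochner_integral G
        (\<lambda>w. (\<Prod>b\<in>D. f b (pd (fst w) b) (pd (snd w) b)) *
          exp (\<Sum>b\<in>blocks - D. (\<alpha>(b0 := a)) b * pd (fst w) b + (\<beta>(b0 := a')) b * pd (snd w) b))
        ((\<Prod>b\<in>D. m b) * exp (\<Sum>b\<in>blocks - D. \<sigma>\<^sup>2 * (((\<alpha>(b0 := a)) b)\<^sup>2 + ((\<beta>(b0 := a')) b)\<^sup>2)))"
        using insert.prems by (intro insert.IH) auto
      then show ?case
        unfolding sum_remove sums exp_add R_def r_def by (simp add: mult_ac)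
    next
      case (exp_comb_add g k g' k')
      then show ?case
        using has_bochner_integral_add by (fastforce simp: distrib_right)
    next
      case (exp_comb_cmult g k a)
      then show ?case
        using has_bochner_integral_mult_right[of a] by (fastforce simp: mult.assoc)
    qed
    from this[OF insert.prems(2)[of b0]] show ?case
      using insert.hyps by (simp add: R_def r_def mult.assoc)
  qed
qed

lemma integral_prod_blocks:
  assumes "\<And>b. b \<in> blocks \<Longrightarrow> exp_comb \<sigma> (f b) (m b)"
  shows "has_bochner_integral G
     (\<lambda>w. \<Prod>b\<in>blocks. f b (pd (fst w) b) (pd (snd w) b)) (\<Prod>b\<in>blocks. m b)"
  using integral_prod_exp[OF subset_refl assms] by simp

section \<open>Likelihoods of the hypotheses and their averages over the signs\<close>

text \<open>The displacement of the points is \<open>\<plusminus>\<sigma>\<^sup>2 u\<close>, so \<open>u = h / (2 \<sigma>\<^sup>2)\<close>.\<close>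
definition \<theta> :: "real \<Rightarrow> (nat \<times> nat \<Rightarrow> real) \<Rightarrow> nat \<Rightarrow> nat \<Rightarrow> real" where
  "\<theta> u \<epsilon> i k = c (i, k) + \<sigma>\<^sup>2 * tilt (\<lambda>b. u * \<epsilon> b) (i, k)"

abbreviation swap :: "nat \<Rightarrow> nat \<Rightarrow> nat" where
  "swap i \<equiv> Transposition.transpose (2*i) (2*i+1)"

definition orient :: "nat \<Rightarrow> nat \<times> nat \<Rightarrow> real" where
  "orient i b = (if fst b = i then -1 else 1)"

definition signs :: "(nat \<times> nat \<Rightarrow> real) set" where
  "signs = PiE blocks (\<lambda>_. {-1, 1})"

definition lik :: "real \<Rightarrow> nat \<Rightarrow> (nat \<times> nat \<Rightarrow> real) \<Rightarrow> (nat \<times> nat \<Rightarrow> real) \<times> (nat \<times> nat \<Rightarrow> real) \<Rightarrow> real" where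
  "lik u i \<epsilon> w = (\<Prod>b\<in>blocks. exp (- 2 * \<sigma>\<^sup>2 * u\<^sup>2) *
      exp (\<epsilon> b * (u * (pd (fst w) b + orient i b * pd (snd w) b))))"

text \<open>A general \<open>z\<close> covers both a swapped pair (\<open>orient i\<close>) and the
  reference mixture without a swap (constant 1).\<close>

definition mean_lik :: "real \<Rightarrow> (nat \<times> nat \<Rightarrow> real) \<Rightarrow> (nat \<times> nat \<Rightarrow> real) \<times> (nat \<times> nat \<Rightarrow> real) \<Rightarrow> real" where
  "mean_lik u z w = (\<Prod>b\<in>blocks. lr \<sigma> u (z b) (pd (fst w) b) (pd (snd w) b))"

lemma orient_sq: "(orient i b)\<^sup>2 = 1"
  by (simp add: orient_def)

lemma lik_measurable [measurable]: "lik u i \<epsilon> \<in> borel_measurable G"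
  unfolding lik_def[abs_def] by measurable

lemma lik_nonneg: "lik u i \<epsilon> w \<ge> 0"
  unfolding lik_def by (simp add: prod_nonneg)

lemma mean_lik_pos: "mean_lik u z w > 0"
  unfolding mean_lik_def by (simp add: prod_pos lr_pos)

text \<open>As the two points of a pair share their centre, swapping them only negates the tilt of
  that pair in the second sample.\<close>

lemma law_eq_density:
  assumes i: "i < M" and \<epsilon>: "\<epsilon> \<in> signs"
  shows "law n d (\<theta> u \<epsilon>) (\<lambda>_. \<sigma>) (swap i) = density G (\<lambda>w. ennreal (lik u i \<epsilon> w))"
proof -
  let ?\<alpha> = "\<lambda>b. u * \<epsilon> b" and ?\<beta> = "\<lambda>b. u * orient i b * \<epsilon> b"
  have \<theta>_swap: "\<theta> u \<epsilon> (swap i j) k = c (j, k) + \<sigma>\<^sup>2 * tilt ?\<beta> (j, k)" for j k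
  proof -
    consider "j = 2*i" | "j = 2*i+1" | "j \<noteq> 2*i" "j \<noteq> 2*i+1" by blast
    then show ?thesis
    proof cases
      case 3
      then have "j div 2 \<noteq> i" by presburger
      with 3 show ?thesis by (simp add: \<theta>_def tilt_def orient_def)
    qed (use i centre_eq[OF i, of k] in \<open>simp_all add: \<theta>_def tilt_def orient_def\<close>)
  qed
  have \<epsilon>_sq: "(\<epsilon> b)\<^sup>2 = 1" if "b \<in> blocks" for b
    using \<epsilon> that by (auto simp: signs_def PiE_iff)
  have "law n d (\<theta> u \<epsilon>) (\<lambda>_. \<sigma>) (swap i) =
      gauss (idx n d) (\<lambda>i. c i + \<sigma>\<^sup>2 * tilt ?\<alpha> i) \<sigma> \<Otimes>\<^sub>M gauss (idx n d) (\<lambda>i. c i + \<sigma>\<^sup>2 * tilt ?\<beta> i) \<sigma>"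
    unfolding law_def gauss_def split_beta \<theta>_swap by (simp add: \<theta>_def)
  also have "\<dots> = density G (\<lambda>w. ennreal (lik u i \<epsilon> w))"
    unfolding tilted_law lik_def
    by (intro arg_cong[where f="density G"] ext arg_cong[where f=ennreal])
      (auto simp: exp_sum exp_add[symmetric] \<epsilon>_sq orient_sq power_mult_distrib algebra_simps intro!: prod.cong)
  finally show ?thesis .
qed

text \<open>Distributivity: the sum over sign patterns becomes a product over blocks of two-term
  sums, each of them twice a cosh factor.\<close>

lemma sum_signs_lik:
  "(\<Sum>\<epsilon>\<in>signs. lik u i \<epsilon> w) = 2 ^ card blocks * mean_lik u (orient i) w"
proof -
  let ?g = "\<lambda>b e. exp (- 2 * \<sigma>\<^sup>2 * u\<^sup>2) * exp (e * (u * (pd (fst w) b + orient i b * pd (snd w) b))) :: real"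
  have "(\<Sum>\<epsilon>\<in>signs. lik u i \<epsilon> w) = (\<Prod>b\<in>blocks. \<Sum>e\<in>{-1,1}. ?g b e)"
    unfolding lik_def signs_def by (rule prod_sum_PiE[symmetric]) auto
  also have "\<dots> = (\<Prod>b\<in>blocks. 2 * lr \<sigma> u (orient i b) (pd (fst w) b) (pd (snd w) b))"
    by (intro prod.cong refl) (simp add: lr_def cosh_def field_simps)
  finally show ?thesis
    by (simp add: mean_lik_def prod.distrib)
qed

lemma card_signs: "card signs = 2 ^ card blocks"
  unfolding signs_def by (simp add: card_PiE numeral_2_eq_2)

lemma integral_mean_lik:
  assumes "\<And>b. (z b)\<^sup>2 = 1"
  shows "has_bochner_integral G (mean_lik u z) 1"
  using integral_prod_blocks[of "\<lambda>b. lr \<sigma> u (z b)" "\<lambda>_. 1"] assms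
  by (simp add: mean_lik_def[abs_def] exp_comb_lr)

section \<open>From the error of an estimator to the chi-square bound\<close>

lemma estimator_event:
  assumes "i < M" and est: "\<pi>h \<in> estimators n d"
  shows "{w \<in> space G. \<pi>h w = swap i} \<in> sets G"
proof -
  have "swap i permutes {..<n}"
    using assms(1) pairs_le by (intro permutes_swap_id) auto
  moreover have "\<pi>h \<in> measurable G (count_space {p. p permutes {..<n}})"
    using est unfolding estimators_def by (simp cong: measurable_cong_sets add: sets_G)
  moreover have "{w \<in> space G. \<pi>h w = swap i} = \<pi>h -` {swap i} \<inter> space G" by auto
  ultimately show ?thesis by (auto intro: measurable_sets)
qed

text \<open>An error bound valid for every sign pattern also holds for the uniform average over the
  patterns, which turns \<open>lik\<close> into \<open>mean_lik\<close>.\<close>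

lemma mean_success:
  assumes i: "i < M" and est: "\<pi>h \<in> estimators n d"
    and err: "\<And>\<epsilon>. \<epsilon> \<in> signs \<Longrightarrow> err_prob n d (\<theta> u \<epsilon>) (\<lambda>_. \<sigma>) (swap i) \<pi>h \<le> s"
  shows "1 - s \<le> (\<integral>w. mean_lik u (orient i) w * indicator {w \<in> space G. \<pi>h w = swap i} w \<partial>G)"
proof -
  let ?A = "{w \<in> space G. \<pi>h w = swap i}"
  have A[measurable]: "?A \<in> sets G"
    using i est by (rule estimator_event)
  have one: "integrable G (\<lambda>w. lik u i \<epsilon> w * indicator ?A w) \<and>
      1 - s \<le> (\<integral>w. lik u i \<epsilon> w * indicator ?A w \<partial>G)" if \<epsilon>: "\<epsilon> \<in> signs" for \<epsilon>
  proof -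
    let ?P = "density G (\<lambda>w. ennreal (lik u i \<epsilon> w))"
    have "prob_space ?P"
      unfolding law_eq_density[OF i \<epsilon>, symmetric] law_def split_beta
      by (intro prob_space_pair prob_space_PiM prob_space_normal_density \<sigma>_pos)
    then interpret P: prob_space ?P .
    have "integrable ?P (indicator ?A :: _ \<Rightarrow> real)"
    proof (rule integrable_real_indicator)
      show "?A \<in> sets ?P" unfolding sets_density by (rule A)
      show "emeasure ?P ?A < \<infinity>" by (simp only: P.emeasure_eq_measure ennreal_less_top infinity_ennreal_def)
    qed
    then have "integrable G (\<lambda>w. lik u i \<epsilon> w * indicator ?A w)"
      by (subst (asm) integrable_density[OF borel_measurable_indicator[OF A]]) (auto simp: lik_nonneg)
    moreover have "(\<integral>w. lik u i \<epsilon> w * indicator ?A w \<partial>G) = (\<integral>w. indicator ?A w \<partial>?P)"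
      by (subst integral_density[OF borel_measurable_indicator[OF A]]) (auto simp: lik_nonneg)
    moreover have "(\<integral>w. indicator ?A w \<partial>?P) = P.prob ?A"
      by simp (intro arg_cong[where f=P.prob], auto)
    moreover have "P.prob (space ?P - ?A) = 1 - P.prob ?A"
      by (intro P.prob_compl) (unfold sets_density, rule A)
    moreover have "P.prob (space ?P - ?A) = err_prob n d (\<theta> u \<epsilon>) (\<lambda>_. \<sigma>) (swap i) \<pi>h"
      unfolding err_prob_def law_eq_density[OF i \<epsilon>] by (intro arg_cong[where f=P.prob]) auto
    ultimately show ?thesis using err[OF \<epsilon>] by simp
  qed
  have "2 ^ card blocks * (1 - s) = (\<Sum>\<epsilon>\<in>signs. 1 - s)"
    by (simp add: card_signs)
  also have "\<dots> \<le> (\<Sum>\<epsilon>\<in>signs. \<integral>w. lik u i \<epsilon> w * indicator ?A w \<partial>G)"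
    using one by (intro sum_mono) auto
  also have "\<dots> = (\<integral>w. (\<Sum>\<epsilon>\<in>signs. lik u i \<epsilon> w * indicator ?A w) \<partial>G)"
    using one by (intro Bochner_Integration.integral_sum[symmetric]) auto
  also have "\<dots> = 2 ^ card blocks * (\<integral>w. mean_lik u (orient i) w * indicator ?A w \<partial>G)"
    unfolding sum_distrib_right[symmetric] sum_signs_lik mult.assoc by simp
  finally show ?thesis by simp
qed

text \<open>Cauchy-Schwarz against the reference mixture \<open>mean_lik u (\<lambda>_. 1)\<close>, in which no pair is
  swapped: the events that the estimator returns different swaps are disjoint.\<close>
lemma success_bound:
  assumes est: "\<pi>h \<in> estimators n d" and M: "M > 0"
    and err: "\<And>i \<epsilon>. i < M \<Longrightarrow> \<epsilon> \<in> signs \<Longrightarrow> err_prob n d (\<theta> u \<epsilon>) (\<lambda>_. \<sigma>) (swap i) \<pi>h \<le> s"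
    and U: "exp_comb \<sigma> U X" "\<And>p q. (lr \<sigma> u (-1) p q)\<^sup>2 \<le> U p q * lr \<sigma> u 1 p q"
  shows "1 - s \<le> 1/2 + X ^ d / (2 * M)"
proof -
  let ?A = "\<lambda>i. {w \<in> space G. \<pi>h w = swap i}"
  let ?V = "mean_lik u (\<lambda>_. 1)"
  \<comment> \<open>A majorant of the chi-square integrand (\<open>mean_lik\<close> for swap i,
    squared, over the reference): only the factors of pair i differ from the reference, and
    \<open>U\<close> dominates their ratio.\<close>
  define W where "W = (\<lambda>i w. \<Prod>b\<in>blocks.
    (if fst b = i then U else lr \<sigma> u 1) (pd (fst w) b) (pd (snd w) b))"
  have A[measurable]: "?A i \<in> sets G" if "i < M" for i
    using that est by (rule estimator_event)
  have U_nonneg: "0 \<le> U p q" for p q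
    using U(2)[of p q] lr_pos[of \<sigma> u 1 p q] by (smt (verit) mult_neg_pos zero_le_power2)
  have W_nonneg: "0 \<le> W i w" for i w
    unfolding W_def using U_nonneg lr_pos by (auto intro!: prod_nonneg simp: less_imp_le)
  \<comment> \<open>Blocks outside pair i contribute mean 1, and pair i consists of \<open>d\<close>
    blocks.\<close>
  have W_int: "has_bochner_integral G (W i) (X ^ d)" if i: "i < M" for i
  proof -
    have "has_bochner_integral G (W i) (\<Prod>b\<in>blocks. if fst b = i then X else 1)"
      unfolding W_def using U(1) by (intro integral_prod_blocks) (auto simp: exp_comb_lr)
    also have "(\<Prod>b\<in>blocks. if fst b = i then X else 1) = (\<Prod>b\<in>blocks \<inter> {b. fst b = i}. X)"
      by (subst prod.If_cases) auto
    also have "blocks \<inter> {b. fst b = i} = {i} \<times> {..<d}"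
      using i by (auto simp: blocks_def)
    finally show ?thesis by (simp add: card_cartesian_product)
  qed
  have V_int: "has_bochner_integral G ?V 1"
    by (rule integral_mean_lik) simp
  \<comment> \<open>Cauchy-Schwarz in pointwise AM-GM form. The weight \<open>M\<close> is chosen so
    that, averaged over the \<open>M\<close> disjoint success events, the reference terms contribute
    at most 1/2.\<close>
  have pointwise: "mean_lik u (orient i) w \<le> M / 2 * ?V w + W i w / (2 * M)" for i w
  proof -
    let ?L = "mean_lik u (orient i) w"
    have "?L\<^sup>2 = (\<Prod>b\<in>blocks. (lr \<sigma> u (orient i b) (pd (fst w) b) (pd (snd w) b))\<^sup>2)"
      unfolding mean_lik_def by (simp add: prod_power_distrib)
    also have "\<dots> \<le> (\<Prod>b\<in>blocks. (if fst b = i then U else lr \<sigma> u 1) (pd (fst w) b) (pd (snd w) b)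
        * lr \<sigma> u 1 (pd (fst w) b) (pd (snd w) b))"
      using U(2) by (intro prod_mono) (auto simp: orient_def power2_eq_square)
    also have "\<dots> = W i w * ?V w"
      unfolding W_def mean_lik_def by (simp add: prod.distrib)
    finally have "?L\<^sup>2 \<le> W i w * ?V w" .
    also have "\<dots> = (M / 2 * ?V w + W i w / (2 * M))\<^sup>2 - (M / 2 * ?V w - W i w / (2 * M))\<^sup>2"
      using M by (simp add: power2_eq_square algebra_simps)
    also have "\<dots> \<le> (M / 2 * ?V w + W i w / (2 * M))\<^sup>2" by simp
    finally show ?thesis
      using mean_lik_pos[of u "\<lambda>_. 1" w] W_nonneg[of i w]
      by (intro power2_le_imp_le[of ?L]) (auto simp: less_imp_le)
  qed
  have V_ind: "integrable G (\<lambda>w. ?V w * indicator (?A i) w)" if "i < M" for i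
    using V_int A[OF that] by (intro integrable_real_mult_indicator) (auto simp: has_bochner_integral_iff)
  have each: "1 - s \<le> M / 2 * (\<integral>w. ?V w * indicator (?A i) w \<partial>G) + X ^ d / (2 * M)" if i: "i < M" for i
  proof -
    have "1 - s \<le> (\<integral>w. mean_lik u (orient i) w * indicator (?A i) w \<partial>G)"
      by (rule mean_success[OF i est err[OF i]])
    also have "\<dots> \<le> (\<integral>w. M / 2 * (?V w * indicator (?A i) w) + W i w / (2 * M) \<partial>G)"
    proof (rule integral_mono)
      show "integrable G (\<lambda>w. mean_lik u (orient i) w * indicator (?A i) w)"
        using integral_mean_lik[of "orient i" u] orient_sq A[OF i]
        by (intro integrable_real_mult_indicator) (auto simp: has_bochner_integral_iff)
      show "integrable G (\<lambda>w. M / 2 * (?V w * indicator (?A i) w) + W i w / (2 * M))"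
        using V_ind[OF i] W_int[OF i] by (auto simp: has_bochner_integral_iff)
      show "mean_lik u (orient i) w * indicator (?A i) w
          \<le> M / 2 * (?V w * indicator (?A i) w) + W i w / (2 * M)" for w
        using pointwise[of i w] W_nonneg[of i w] by (auto simp: indicator_def)
    qed
    also have "\<dots> = M / 2 * (\<integral>w. ?V w * indicator (?A i) w \<partial>G) + X ^ d / (2 * M)"
      using V_ind[OF i] W_int[OF i] by (simp add: has_bochner_integral_iff)
    finally show ?thesis .
  qed
  have "(\<Sum>i<M. \<integral>w. ?V w * indicator (?A i) w \<partial>G) = (\<integral>w. (\<Sum>i<M. ?V w * indicator (?A i) w) \<partial>G)"
    using V_ind by (intro Bochner_Integration.integral_sum[symmetric]) auto
  also have "\<dots> \<le> (\<integral>w. ?V w \<partial>G)"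
  proof (rule integral_mono)
    show "integrable G (\<lambda>w. \<Sum>i<M. ?V w * indicator (?A i) w)"
      using V_ind by (intro Bochner_Integration.integrable_sum) auto
    show "integrable G ?V" using V_int by (simp add: has_bochner_integral_iff)
    show "(\<Sum>i<M. ?V w * indicator (?A i) w) \<le> ?V w" for w
    proof -
      have inj: "i = j" if "swap i = swap j" for i j
        using fun_cong[OF that, of "2*i"] by (auto simp: Transposition.transpose_def split: if_splits)
      then have "disjoint_family_on ?A {..<M}"
        by (force simp: disjoint_family_on_def)
      then have "(\<Sum>i<M. indicator (?A i) w :: real) = indicator (\<Union>i<M. ?A i) w"
        by (intro indicator_UN_disjoint[symmetric]) auto
      also have "\<dots> \<le> 1" by (simp add: indicator_def)
      finally show ?thesis
        using mean_lik_pos[of u "\<lambda>_. 1" w] by (simp add: sum_distrib_left[symmetric] mult_left_le)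
    qed
  qed
  also have "\<dots> = 1" using V_int by (simp add: has_bochner_integral_iff)
  finally have total: "(\<Sum>i<M. \<integral>w. ?V w * indicator (?A i) w \<partial>G) \<le> 1" .
  have "M * (1 - s) = (\<Sum>i<M. 1 - s)" by simp
  also have "\<dots> \<le> (\<Sum>i<M. M / 2 * (\<integral>w. ?V w * indicator (?A i) w \<partial>G) + X ^ d / (2 * M))"
    using each by (intro sum_mono) auto
  also have "\<dots> = M / 2 * (\<Sum>i<M. \<integral>w. ?V w * indicator (?A i) w \<partial>G) + X ^ d / 2"
    using M by (simp add: sum.distrib sum_distrib_left)
  also have "\<dots> \<le> M / 2 * 1 + X ^ d / 2"
    using total by (intro add_right_mono mult_left_mono) auto
  finally show ?thesis using M by (simp add: field_simps)
qed

end

section \<open>Reduction of the minimax risk\<close>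

lemma prob_space_law: "\<sigma> > 0 \<Longrightarrow> prob_space (law n d \<theta> (\<lambda>_. \<sigma>) \<pi>)"
  unfolding law_def split_beta
  by (intro prob_space_pair prob_space_PiM prob_space_normal_density)

lemma err_prob_le_1: "\<sigma> > 0 \<Longrightarrow> err_prob n d \<theta> (\<lambda>_. \<sigma>) \<pi> \<pi>h \<le> 1"
  unfolding err_prob_def by (intro prob_space.prob_le_1 prob_space_law)

text \<open>Probabilities are bounded by 1 and there are finitely many permutations, so the real
  \<open>SUP\<close> and the \<open>Max\<close> are genuine upper bounds.\<close>

lemma err_prob_le_max_risk:
  assumes "\<sigma> > 0" "\<pi> permutes {..<n}" "\<theta> \<in> \<Theta>"
  shows "err_prob n d \<theta> (\<lambda>_. \<sigma>) \<pi> \<pi>h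
    \<le> Max ((\<lambda>\<pi>. SUP \<theta>\<in>\<Theta>. err_prob n d \<theta> (\<lambda>_. \<sigma>) \<pi> \<pi>h) ` {\<pi>. \<pi> permutes {..<n}})"
proof -
  have "err_prob n d \<theta> (\<lambda>_. \<sigma>) \<pi> \<pi>h \<le> (SUP \<theta>\<in>\<Theta>. err_prob n d \<theta> (\<lambda>_. \<sigma>) \<pi> \<pi>h)"
    using err_prob_le_1[OF assms(1)] assms(3) by (intro cSUP_upper bdd_aboveI2[where M=1])
  also have "\<dots> \<le> Max ((\<lambda>\<pi>. SUP \<theta>\<in>\<Theta>. err_prob n d \<theta> (\<lambda>_. \<sigma>) \<pi> \<pi>h) ` {\<pi>. \<pi> permutes {..<n}})"
    using assms(2) by (intro Max_ge) (auto simp: finite_permutations)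
  finally show ?thesis .
qed

lemma le_sep:
  assumes "n \<ge> 2" "\<And>i j. i < n \<Longrightarrow> j < n \<Longrightarrow> i \<noteq> j \<Longrightarrow> \<kappa> \<le> vdist d \<theta> i j"
  shows "\<kappa> \<le> sep n d \<theta>"
proof -
  let ?S = "{vdist d \<theta> i j | i j. i < n \<and> j < n \<and> i \<noteq> j}"
  have "?S \<subseteq> (\<lambda>(i, j). vdist d \<theta> i j) ` ({..<n} \<times> {..<n})" by auto
  then have "finite ?S" by (rule finite_subset) auto
  moreover have "vdist d \<theta> 0 1 \<in> ?S" using assms(1) by fastforce
  ultimately show ?thesis
    unfolding sep_def using assms(2) by (subst Min_ge_iff) auto
qed

section \<open>The configuration of points and its separation\<close>

lemma vdist_ge_coord: "k < d \<Longrightarrow> \<bar>\<theta> i k - \<theta> j k\<bar> \<le> vdist d \<theta> i j"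
  unfolding vdist_def real_sqrt_abs[symmetric]
  by (intro real_sqrt_le_mono member_le_sum[where f="\<lambda>k. (\<theta> i k - \<theta> j k)\<^sup>2"]) auto

text \<open>Pairs sit on the first axis at spacing \<open>2 * \<kappa>\<close>, which leaves room
  for the displacements inside the pairs.\<close>

definition centre :: "real \<Rightarrow> nat \<times> nat \<Rightarrow> real" where
  "centre \<kappa> = (\<lambda>(i, k). if k = 0 then 2 * \<kappa> * real (i div 2) else 0)"

lemma paired_points_centre:
  "\<sigma> > 0 \<Longrightarrow> paired_points n (n div 2) (centre \<kappa>) \<sigma>"
  by unfold_locales (auto simp: centre_def)

text \<open>Within a pair every coordinate differs by exactly h in absolute value, so the distance
  is sqrt d * h = \<open>\<kappa>\<close> for every sign pattern. Points of different pairs differ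
  in coordinate 0 by at least \<open>2 * \<kappa> - h\<close>, and h <=
  \<open>\<kappa>\<close>.\<close>

lemma sep_paired_points:
  assumes n: "n \<ge> 2" and d: "d \<ge> 1" and \<sigma>: "\<sigma> > 0" and \<kappa>: "\<kappa> > 0"
    and \<epsilon>: "\<epsilon> \<in> paired_points.signs d (n div 2)"
  shows "\<kappa> \<le> sep n d (paired_points.\<theta> (n div 2) (centre \<kappa>) \<sigma> (\<kappa> / (2 * \<sigma>\<^sup>2 * sqrt d)) \<epsilon>)"
proof -
  interpret paired_points n d "n div 2" "centre \<kappa>" \<sigma>
    using \<sigma> by (rule paired_points_centre)
  define h where "h = \<kappa> / sqrt d"
  let ?t = "\<theta> (\<kappa> / (2 * \<sigma>\<^sup>2 * sqrt d)) \<epsilon>"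
  have h: "0 < h" "h \<le> \<kappa>" "d * h\<^sup>2 = \<kappa>\<^sup>2"
    using d \<kappa> unfolding h_def by (auto simp: field_simps power_divide)
  have \<epsilon>1: "\<epsilon> (a, k) = 1 \<or> \<epsilon> (a, k) = -1" if "a < n div 2" "k < d" for a k
    using \<epsilon> that by (auto simp: signs_def blocks_def PiE_iff)
  have t: "?t i k = centre \<kappa> (i, k) + (if i < 2 * (n div 2) then (-1)^i * \<epsilon> (i div 2, k) * (h / 2) else 0)" for i k
    using \<sigma> by (simp add: \<theta>_def tilt_def h_def field_simps)
  have dev: "\<bar>?t i k - centre \<kappa> (i, k)\<bar> \<le> h / 2" if "k < d" for i k
    using \<epsilon>1[of "i div 2" k] that h unfolding t
    by (cases "i < 2 * (n div 2)") (auto simp: abs_mult power_abs less_mult_imp_div_less mult.commute[of 2])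
  show ?thesis
  proof (rule le_sep[OF n])
    fix i j assume ij: "i < n" "j < n" "i \<noteq> j"
    show "\<kappa> \<le> vdist d ?t i j"
    proof (cases "i div 2 = j div 2")
      case True
      have "even i \<noteq> even j"
        using True ij(3) by (metis even_two_times_div_two odd_two_times_div_two_succ)
      \<comment> \<open>Two distinct indices with the same half form a complete pair; the leftover
        index of an odd \<open>n\<close> has no partner.\<close>
      then have "i div 2 < n div 2"
        using True ij(1,2) by (cases "even i") (auto elim!: evenE oddE)
      then have lt: "i < 2 * (n div 2)" "j < 2 * (n div 2)"
        using True by linarith+
      have sgn: "(-1::real)^i = - ((-1)^j)"
        using \<open>even i \<noteq> even j\<close> by (auto simp: minus_one_power_iff)
      have "(?t i k - ?t j k)\<^sup>2 = h\<^sup>2" if "k < d" for k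
      proof -
        have "?t i k - ?t j k = - (2 * (-1)^j * \<epsilon> (j div 2, k) * (h / 2))"
          unfolding t using lt True by (simp add: sgn centre_def)
        moreover have "\<epsilon> (j div 2, k) = 1 \<or> \<epsilon> (j div 2, k) = -1"
          using \<open>i div 2 < n div 2\<close> True that by (intro \<epsilon>1) auto
        ultimately show ?thesis
          by (auto simp: power_mult_distrib power_divide minus_one_power_iff)
      qed
      then have "vdist d ?t i j = sqrt (\<kappa>\<^sup>2)"
        unfolding vdist_def h(3)[symmetric] by simp
      then show ?thesis using \<kappa> by simp
    next
      case False
      have "1 \<le> \<bar>real (i div 2) - real (j div 2)\<bar>"
        using False by linarith
      then have "2 * \<kappa> * 1 \<le> 2 * \<kappa> * \<bar>real (i div 2) - real (j div 2)\<bar>"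
        using \<kappa> by (intro mult_left_mono) auto
      also have "\<dots> = \<bar>centre \<kappa> (i, 0) - centre \<kappa> (j, 0)\<bar>"
        using \<kappa> by (simp add: centre_def right_diff_distrib[symmetric] abs_mult)
      finally have "\<kappa> \<le> \<bar>?t i 0 - ?t j 0\<bar>"
        using dev[of 0 i] dev[of 0 j] d h(2) by (smt (verit) field_sum_of_halves less_le_trans zero_less_one)
      also have "\<dots> \<le> vdist d ?t i j"
        using d by (intro vdist_ge_coord) auto
      finally show ?thesis .
    qed
  qed
qed

section \<open>Calibration of the separation and conclusion\<close>

text \<open>Here \<open>l\<close> stands for log n, and the factor 1 is the constant c of the
  theorem. If the square root attains the maximum, convexity gives exactly l/16 in the exponent;
  otherwise the second order bound gives 240 l / 4096, which is smaller.\<close>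

lemma lr_ratio_bound:
  fixes d :: nat and l :: real
  assumes d: "d \<ge> 1" and \<sigma>: "\<sigma> > 0" and l: "l > 0"
    and \<kappa>: "\<kappa> = 2 powr (-5/2) * \<sigma> * max (sqrt l) ((1 * real d * l) powr (1/4))"
  shows "\<exists>U X. exp_comb \<sigma> U X \<and> X ^ d \<le> exp (l / 16) \<and>
    (\<forall>p q. (lr \<sigma> (\<kappa> / (2 * \<sigma>\<^sup>2 * sqrt d)) (-1) p q)\<^sup>2 \<le> U p q * lr \<sigma> (\<kappa> / (2 * \<sigma>\<^sup>2 * sqrt d)) 1 p q)"
proof -
  let ?u = "\<kappa> / (2 * \<sigma>\<^sup>2 * sqrt d)"
  have two: "(2 powr (-5/2))\<^sup>2 = (1/32 :: real)"
  proof -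
    have "(2 powr (-5/2))\<^sup>2 = (2::real) powr (-5)"
      by (subst powr_power) auto
    then show ?thesis by (simp add: powr_minus)
  qed
  have root: "((d * l) powr (1/4))\<^sup>2 = sqrt (d * l)"
    using d l by (simp add: powr_power powr_half_sqrt)
  have u: "2 * \<sigma>\<^sup>2 * ?u\<^sup>2 = \<kappa>\<^sup>2 / (2 * \<sigma>\<^sup>2 * d)"
    using \<sigma> d by (simp add: power2_eq_square field_simps)
  show ?thesis
  proof (cases "sqrt l \<ge> (d * l) powr (1/4)")
    case True
    then have "\<kappa>\<^sup>2 = \<sigma>\<^sup>2 * l / 32"
      unfolding \<kappa> power_mult_distrib two using l by (simp add: max_absorb1)
    then have "\<kappa>\<^sup>2 / (2 * \<sigma>\<^sup>2 * d) = l / (64 * d)"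
      using \<sigma> d by (simp add: field_simps)
    then have "8 * \<sigma>\<^sup>2 * ?u\<^sup>2 = l / (16 * d)"
      using u by (simp add: mult.assoc)
    then have "exp (8 * \<sigma>\<^sup>2 * ?u\<^sup>2) ^ d = exp (l / 16)"
      using d by (simp add: exp_of_nat_mult[symmetric])
    then show ?thesis
      using lr_ratio_convex[of \<sigma> ?u] by (metis order_refl)
  next
    case False
    then have \<kappa>2: "\<kappa>\<^sup>2 = \<sigma>\<^sup>2 * sqrt (d * l) / 32"
      unfolding \<kappa> power_mult_distrib two using l by (simp add: max_absorb2 root)
    \<comment> \<open>In this regime l <= d, hence sqrt (d l) <= d, which provides the smallness
      that the second order bound requires.\<close>
    have "(sqrt l)\<^sup>2 \<le> ((d * l) powr (1/4))\<^sup>2"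
      using False l by (intro power_mono) auto
    then have "l \<le> sqrt (d * l)" unfolding root using l by simp
    then have "l\<^sup>2 \<le> d * l" using l d by (simp add: real_le_rsqrt real_le_lsqrt sqrt_ge_absD)
    then have "l \<le> d" using l by (simp add: power2_eq_square)
    then have sq: "sqrt (d * l) \<le> d"
      using l by (intro real_le_lsqrt) (auto simp: power2_eq_square)
    have \<tau>: "2 * \<sigma>\<^sup>2 * ?u\<^sup>2 = sqrt (d * l) / (64 * d)"
      unfolding u \<kappa>2 using \<sigma> d by (simp add: field_simps)
    have "2 * \<sigma>\<^sup>2 * ?u\<^sup>2 \<le> 1/2"
      unfolding \<tau> using sq d by (simp add: field_simps)
    from lr_ratio_second_order[OF this] obtain U X where UX: "exp_comb \<sigma> U X" "0 \<le> X"
      "X \<le> exp (240 * (2 * \<sigma>\<^sup>2 * ?u\<^sup>2)\<^sup>2)"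
      "\<forall>p q. (lr \<sigma> ?u (-1) p q)\<^sup>2 \<le> U p q * lr \<sigma> ?u 1 p q" by blast
    have "(2 * \<sigma>\<^sup>2 * ?u\<^sup>2)\<^sup>2 = l / (4096 * d)"
      unfolding \<tau> using d l by (simp add: power_divide power_mult_distrib) (simp add: power2_eq_square)
    then have "X ^ d \<le> exp (240 * (l / (4096 * d))) ^ d"
      using UX(2,3) by (intro power_mono) auto
    also have "\<dots> = exp (240 * l / 4096)"
      using d by (simp add: exp_of_nat_mult[symmetric])
    also have "\<dots> \<le> exp (l / 16)" using l by simp
    finally show ?thesis using UX by blast
  qed
qed

lemma estimators_nonempty: "estimators n d \<noteq> {}"
proof -
  have "(\<lambda>_. id) \<in> estimators n d"
    unfolding estimators_def by (simp add: permutes_id)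
  then show ?thesis by blast
qed

theorem theorem2:
  shows "\<exists>c>0. \<exists>C>0. \<forall>n::nat. \<forall>d::nat. \<forall>\<sigma>::real.
     n \<ge> 6 \<longrightarrow> d \<ge> 1 \<longrightarrow> \<sigma> > 0 \<longrightarrow>
     (let \<kappa> = 2 powr (-5/2) * \<sigma> * max (sqrt (ln (real n))) ((c * real d * ln (real n)) powr (1/4));
          \<Theta> = {\<theta>. sep n d \<theta> \<ge> \<kappa>}
      in (INF \<pi>h \<in> estimators n d.
            Max ((\<lambda>\<pi>. SUP \<theta> \<in> \<Theta>. err_prob n d \<theta> (\<lambda>_. \<sigma>) \<pi> \<pi>h) ` {\<pi>. \<pi> permutes {..<n}}))
         > C)"
proof -
  have "1/5 < (INF \<pi>h \<in> estimators n d.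
      Max ((\<lambda>\<pi>. SUP \<theta> \<in> {\<theta>. sep n d \<theta> \<ge> \<kappa>}. err_prob n d \<theta> (\<lambda>_. \<sigma>) \<pi> \<pi>h) ` {\<pi>. \<pi> permutes {..<n}}))"
    (is "_ < (INF \<pi>h \<in> _. ?risk \<pi>h)")
    if n: "n \<ge> 6" and d: "d \<ge> 1" and \<sigma>: "\<sigma> > 0"
      and \<kappa>: "\<kappa> = 2 powr (-5/2) * \<sigma> * max (sqrt (ln (real n))) ((1 * real d * ln (real n)) powr (1/4))"
    for n d :: nat and \<sigma> \<kappa> :: real
  proof -
    let ?M = "n div 2" and ?u = "\<kappa> / (2 * \<sigma>\<^sup>2 * sqrt d)"
    interpret paired_points n d ?M "centre \<kappa>" \<sigma>
      using \<sigma> by (rule paired_points_centre)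
    have ln: "ln (real n) > 0" using n by simp
    then have \<kappa>_pos: "\<kappa> > 0"
      unfolding \<kappa> using \<sigma> by (intro mult_pos_pos) (auto simp: less_max_iff_disj)
    obtain U X where U: "exp_comb \<sigma> U X" and X: "X ^ d \<le> exp (ln n / 16)"
      and lr: "\<And>p q. (lr \<sigma> ?u (-1) p q)\<^sup>2 \<le> U p q * lr \<sigma> ?u 1 p q"
      using lr_ratio_bound[OF d \<sigma> ln \<kappa>] by blast
    \<comment> \<open>Bernoulli for the sixteenth power bounds n^(1/16) by 1 + y, which is linear in
      n and can be compared with the number of pairs.\<close>
    define y where "y = (real n - 1) / 16"
    have y: "0 \<le> y" "real n = 1 + 16 * y" using n by (auto simp: y_def field_simps)
    have "exp (ln n / 16) ^ 16 = real n"
      using n by (simp add: exp_of_nat_mult[symmetric])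
    also have "\<dots> \<le> (1 + y) ^ 16"
      using Bernoulli_inequality[of y 16] y by simp
    finally have "exp (ln n / 16) \<le> 1 + y"
      by (subst (asm) power_mono_iff) (use y(1) in auto)
    \<comment> \<open>As ?M >= (n - 1)/2, it suffices that (n + 15)/16 <= 21/40 * (n - 1)/2, which
      is equivalent to n >= 6.\<close>
    also have "\<dots> \<le> 21/40 * real ?M"
    proof -
      have "real n \<le> 2 * real ?M + 1" by linarith
      then show ?thesis using n y by linarith
    qed
    finally have XM: "X ^ d \<le> 21/40 * real ?M" using X by simp
    \<comment> \<open>19/80 = 1/2 - 21/80. This uniform bound passes to the infimum and lies
      strictly above 1/5.\<close>
    have "19/80 \<le> ?risk \<pi>h" if \<pi>h: "\<pi>h \<in> estimators n d" for \<pi>h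
    proof -
      have "1 - ?risk \<pi>h \<le> 1/2 + X ^ d / (2 * ?M)"
      proof (rule success_bound[OF \<pi>h _ _ U lr])
        show "?M > 0" using n by simp
        fix i \<epsilon> assume i: "i < ?M" and \<epsilon>: "\<epsilon> \<in> signs"
        have "swap i permutes {..<n}"
          using i by (intro permutes_swap_id) auto
        then show "err_prob n d (\<theta> ?u \<epsilon>) (\<lambda>_. \<sigma>) (swap i) \<pi>h \<le> ?risk \<pi>h"
          using sep_paired_points[OF _ d \<sigma> \<kappa>_pos \<epsilon>] n
          by (intro err_prob_le_max_risk \<sigma>) auto
      qed
      also have "X ^ d / (2 * ?M) \<le> 21/80"
        using XM n by (simp add: field_simps)
      finally show ?thesis by simp
    qed
    then have "19/80 \<le> (INF \<pi>h \<in> estimators n d. ?risk \<pi>h)"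
      by (intro cINF_greatest estimators_nonempty)
    then show ?thesis by simp
  qed
  then show ?thesis
    unfolding Let_def by (intro exI[of _ 1] exI[of _ "1/5"] conjI allI impI) auto
qed

end
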